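(* For every integer $n\ge 4$, $$\sum_{k=0}^{n-4}T_k\left(T_{n-k}+T_{n-k-2}+2T_{n-k-3}+3T_{n-k-4}\right)=(n-2)T_{n-1}-T_{n-2}-3T_{n-3}.$$
   Context: The Tetranacci numbers $T_n$ are defined by $T_0=0$, $T_1=T_2=1$, $T_3=2$ and $T_n=T_{n-1}+T_{n-2}+T_{n-3}+T_{n-4}$ for $n\ge 4$. *)

theory Defs
  imports Main
begin

text \<open>The values are integers so that the subtractions in the theorem are not truncated.\<close>

fun tetranacci :: "nat \<Rightarrow> int" where
  "tetranacci 0 = 0"
| "tetranacci (Suc 0) = 1"
| "tetranacci (Suc (Suc 0)) = 1"
| "tetranacci (Suc (Suc (Suc 0))) = 2"
| "tetranacci (Suc (Suc (Suc (Suc n)))) =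
     tetranacci (Suc (Suc (Suc n))) + tetranacci (Suc (Suc n)) + tetranacci (Suc n) + tetranacci n"

end

theory Submission imports Defs begin

text \<open>
  In terms of generating functions, put \<open>D(z) = 1 - z - z\<^sup>2 - z\<^sup>3 - z\<^sup>4\<close>, so that the
  Tetranacci series is \<open>T(z) = z / D(z)\<close>. Differentiation gives \<open>z T'(z) = T(z) + T(z) V(z)\<close>
  with \<open>V(z) = - z D'(z) / D(z) = (1 + 2 z + 3 z\<^sup>2 + 4 z\<^sup>3) T(z)\<close>. The coefficient of \<open>V\<close> at
  \<open>j + 3\<close> is \<open>T(j + 3) + 2 T(j + 2) + 3 T(j + 1) + 4 T(j)\<close>, which by the recurrence is the
  bracket \<open>T(j + 4) + T(j + 2) + 2 T(j + 1) + 3 T(j)\<close> of the theorem. Comparing coefficients at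
  \<open>n - 1\<close>, the value \<open>(n - 2) T(n - 1)\<close> is the sum of the theorem plus the contributions of the
  remaining coefficients \<open>V(1) = 1\<close> and \<open>V(2) = 3\<close>, namely \<open>T(n - 2) + 3 T(n - 3)\<close>.

  The proof below puts this argument into recurrences. Multiplying a convolution of \<open>T\<close> and
  \<open>g\<close> by \<open>D\<close> leaves \<open>z g\<close>, so the convolution satisfies the Tetranacci recurrence with \<open>g\<close>
  as inhomogeneous term (\<open>tetranacci_convolution_rec\<close>). For \<open>g\<close> the bracket, the right-hand side
  of the theorem satisfies the same recurrence: its factor \<open>n - 2\<close> is smaller by 1, 2, 3, 4
  in the four earlier terms, and these weights are the coefficients 1, 2, 3, 4 of the bracket.
  Since the two sides agree at four consecutive values, they agree everywhere
  (\<open>tetranacci_convolution_bracket\<close>).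
\<close>

definition tetranacci_convolution :: "(nat \<Rightarrow> int) \<Rightarrow> nat \<Rightarrow> int" where
  "tetranacci_convolution g m = (\<Sum>k\<le>m. tetranacci k * g (m - k))"

text \<open>
  This is \<open>D(z) \<cdot> (T(z) \<cdot> g(z)) = z \<cdot> g(z)\<close> read off at a coefficient. Once the sums are split
  so that all of them run over the same range \<open>k \<le> m\<close>, the recurrence for \<open>tetranacci (k + 4)\<close>
  cancels them, and the initial values reduce the split-off terms to \<open>g (m + 3)\<close>.
\<close>

lemma tetranacci_convolution_rec:
  "tetranacci_convolution g (Suc (Suc (Suc (Suc m)))) =
     tetranacci_convolution g (Suc (Suc (Suc m))) + tetranacci_convolution g (Suc (Suc m))
     + tetranacci_convolution g (Suc m) + tetranacci_convolution g m + g (Suc (Suc (Suc m)))"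
  by (simp add: tetranacci_convolution_def sum.atMost_Suc_shift sum.distrib
      distrib_right del: sum.atMost_Suc)

text \<open>
  The shift \<open>n = m + 4\<close> makes every index a sum, so that no truncated subtraction occurs and the
  induction can follow the recurrence.
\<close>

lemma tetranacci_convolution_bracket:
  "tetranacci_convolution
     (\<lambda>j. tetranacci (j + 4) + tetranacci (j + 2) + 2 * tetranacci (j + 1) + 3 * tetranacci j) m
   = (int m + 2) * tetranacci (m + 3) - tetranacci (m + 2) - 3 * tetranacci (m + 1)"
proof (induction m rule: tetranacci.induct)
  case (5 m)
  then show ?case
    by (simp add: tetranacci_convolution_rec algebra_simps numeral_eq_Suc)
qed (simp_all add: tetranacci_convolution_def numeral_eq_Suc)

theorem theorem1:
  fixes n :: nat
  assumes "n \<ge> 4"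
  shows "(\<Sum>k = 0..n - 4. tetranacci k *
            (tetranacci (n - k) + tetranacci (n - k - 2)
              + 2 * tetranacci (n - k - 3) + 3 * tetranacci (n - k - 4)))
         = (int n - 2) * tetranacci (n - 1) - tetranacci (n - 2) - 3 * tetranacci (n - 3)"
proof -
  obtain m where n: "n = m + 4"
    using assms by (metis le_add_diff_inverse2)
  have "(\<Sum>k = 0..n - 4. tetranacci k *
            (tetranacci (n - k) + tetranacci (n - k - 2)
              + 2 * tetranacci (n - k - 3) + 3 * tetranacci (n - k - 4)))
        = tetranacci_convolution
            (\<lambda>j. tetranacci (j + 4) + tetranacci (j + 2) + 2 * tetranacci (j + 1)
                   + 3 * tetranacci j) m"
    unfolding tetranacci_convolution_def
  proof (rule sum.cong)
    fix k assume "k \<in> {..m}"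
    then have "n - k = m - k + 4" "n - k - 2 = m - k + 2" "n - k - 3 = m - k + 1"
        "n - k - 4 = m - k"
      using n by auto
    then show "tetranacci k *
            (tetranacci (n - k) + tetranacci (n - k - 2)
              + 2 * tetranacci (n - k - 3) + 3 * tetranacci (n - k - 4))
        = tetranacci k *
            (tetranacci (m - k + 4) + tetranacci (m - k + 2) + 2 * tetranacci (m - k + 1)
              + 3 * tetranacci (m - k))"
      by (simp only:)
  qed (use n in auto)
  also have "\<dots> = (int n - 2) * tetranacci (n - 1) - tetranacci (n - 2) - 3 * tetranacci (n - 3)"
    unfolding tetranacci_convolution_bracket using n by (simp add: add.commute)
  finally show ?thesis .
qed

end
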